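(* Let $a,i,c$ be integers with $a \ge 2$ and $c \ge 5$. Define $p = 2 - \frac{2}{c}$ and suppose $0 \le i \le p^c(p^{c-1}-2)$. If $a \le \frac{p^c}{c-1}$, then $\mathrm{dor}(a,a+i) \le c-1$.
   Context: For integers $1 \le a \le b$, an $(a,b)$-triple is a triple $(x, ax+d, bx+2d)$ with $x,d$ positive integers. A coloring admits a monochromatic $(a,b)$-triple if all three entries of some $(a,b)$-triple receive the same color. The pair $(a,b)$ is $r$-regular if every $r$-coloring of $\mathbb{N}$ admits a monochromatic $(a,b)$-triple. The degree of regularity $\mathrm{dor}(a,b)$ is the largest $r$ such that $(a,b)$ is $r$-regular, and $\mathrm{dor}(a,b)=\infty$ if $(a,b)$ is $r$-regular for all $r$. *)

theory Defs
  imports Complex_Main "HOL-Library.Extended_Nat" "HOL-Library.FuncSet"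
begin

definition is_triple :: "nat \<Rightarrow> nat \<Rightarrow> nat \<times> nat \<times> nat \<Rightarrow> bool" where
  "is_triple a b t \<longleftrightarrow> (\<exists>x d. 1 \<le> x \<and> 1 \<le> d \<and> t = (x, a * x + d, b * x + 2 * d))"

definition admits_mono_triple :: "(nat \<Rightarrow> nat) \<Rightarrow> nat \<Rightarrow> nat \<Rightarrow> bool" where
  "admits_mono_triple f a b \<longleftrightarrow>
     (\<exists>x y z. is_triple a b (x, y, z) \<and> f x = f y \<and> f y = f z)"

(* The natural numbers being coloured are the positive integers; the value of a
   colouring at 0 is irrelevant. *)
definition regular :: "nat \<Rightarrow> nat \<Rightarrow> nat \<Rightarrow> bool" where
  "regular r a b \<longleftrightarrow> (\<forall>f \<in> {1..} \<rightarrow> {..<r}. admits_mono_triple f a b)"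

(* GREATEST is well defined here: regularity is inherited by smaller r, so if it
   fails for some r then the set of r for which it holds is bounded; and it holds
   for r = 1. *)
definition dor :: "nat \<Rightarrow> nat \<Rightarrow> enat" where
  "dor a b =
     (if \<forall>r\<ge>1. regular r a b then \<infinity> else enat (GREATEST r. 1 \<le> r \<and> regular r a b))"

end

(* Colour n by the residue mod c of its scale, the exponent k with p^k \<le> n < p^(k+1).
   Let (x, y, z) be a monochromatic triple; then z = 2y + (i-a)x. Since y \<ge> ax \<ge> px, the
   scale of y exceeds that of x by at least c, so y \<ge> p^(c-1) x, and the bound on a gives
   z \<ge> 2y - ax \<ge> py. Hence the scale of z exceeds that of y by at least c, which makes z
   larger than the bound on i permits. *)
theory Submission
  imports Defs
begin

definition scale :: "real \<Rightarrow> nat \<Rightarrow> nat" where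
  "scale p n = nat \<lfloor>log p (real n)\<rfloor>"

lemma
  fixes p :: real
  assumes "1 < p" "1 \<le> n"
  shows scale_le: "p ^ scale p n \<le> real n"
    and less_scale: "real n < p ^ (scale p n + 1)"
proof -
  \<comment> \<open>\<open>nat\<close> sends negative floors to 0, so the sign has to be settled
    before \<open>scale\<close> can be identified with the floor.\<close>
  have "0 \<le> log p (real n)"
    using assms by simp
  then have "\<lfloor>log p (real n)\<rfloor> = int (scale p n)"
    by (simp add: scale_def)
  then have "p powr real (scale p n) \<le> real n \<and> real n < p powr real (scale p n + 1)"
    using assms by (auto simp: floor_eq_iff le_log_iff log_less_iff add.commute)
  then show "p ^ scale p n \<le> real n" "real n < p ^ (scale p n + 1)"
    using powr_realpow[of p] assms(1) by (metis less_trans zero_less_one)+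
qed

text \<open>Multiplying by p raises the scale by exactly one.\<close>

lemma scale_less:
  fixes p :: real
  assumes "1 < p" "1 \<le> m" "1 \<le> n" "p * real m \<le> real n"
  shows "scale p m < scale p n"
proof -
  have "p ^ (scale p m + 1) \<le> p * real m"
    using assms scale_le[of p m] by simp
  also have "\<dots> < p ^ (scale p n + 1)"
    using assms less_scale[of p n] by linarith
  finally have "scale p m + 1 < scale p n + 1"
    using assms(1) by (simp only: power_strict_increasing_iff)
  then show ?thesis by simp
qed

text \<open>Turns equality of colours plus a strict increase of scale into a jump of at least
  c.\<close>

lemma add_le_of_mod_eq:
  fixes m n c :: nat
  assumes "m < n" "m mod c = n mod c"
  shows "m + c \<le> n"
proof -
  have "c dvd n - m"
    using assms mod_eq_dvd_iff_nat[of m n c] by simp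
  then have "c \<le> n - m"
    using assms(1) by (intro dvd_imp_le) auto
  then show ?thesis
    using assms(1) by simp
qed

text \<open>The colouring argument works for any base p in (1, 2] meeting these bounds; the
  particular value of p enters only in the main theorem. The bound \<open>p2\<close> keeps the
  factor p^(c-1) - 2 nonnegative, so that inequalities may be multiplied by it.\<close>

lemma not_regular_scale:
  fixes p :: real
  assumes p: "1 < p" "p \<le> 2" "p \<le> real a" and c: "0 < c" and p2: "2 \<le> p ^ (c - 1)"
    and a: "real a \<le> (2 - p) * p ^ (c - 1)"
    and i: "real i - real a \<le> p ^ c * (p ^ (c - 1) - 2)"
  shows "\<not> regular c a (a + i)"
proof
  assume "regular c a (a + i)"
  moreover have "(\<lambda>n. scale p n mod c) \<in> {1..} \<rightarrow> {..<c}"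
    using c by auto
  ultimately have "admits_mono_triple (\<lambda>n. scale p n mod c) a (a + i)"
    unfolding regular_def by blast
  then obtain x y z d where x: "1 \<le> x" and d: "1 \<le> d"
    and y: "y = a * x + d" and z: "z = (a + i) * x + 2 * d"
    and xy: "scale p x mod c = scale p y mod c" and yz: "scale p y mod c = scale p z mod c"
    by (auto simp: admits_mono_triple_def is_triple_def)
  define K L M where "K = scale p x" and "L = scale p y" and "M = scale p z"
  have y1: "1 \<le> y" and z1: "1 \<le> z"
    using d y z by auto
  have z_eq: "real z = 2 * real y + (real i - real a) * real x"
    by (simp add: y z algebra_simps)
  have pc: "p ^ c = p * p ^ (c - 1)"
    using c by (cases c) auto

  have "p * real x \<le> real a * real x"
    using p(3) by (simp add: mult_right_mono)
  also have "\<dots> \<le> real y"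
    by (simp add: y)
  finally have KL: "K + c \<le> L"
    unfolding K_def L_def by (intro add_le_of_mod_eq scale_less p(1) x y1 xy)

  \<comment> \<open>Only x < p^(K+1) is known from above, so one of the c factors of p gained
    between the scales is lost.\<close>
  have "p ^ (c - 1) * real x \<le> p ^ (c - 1) * p ^ (K + 1)"
    using p(1) less_scale[OF p(1) x] by (intro mult_left_mono) (auto simp: K_def)
  also have "\<dots> = p ^ (K + c)"
    by (simp add: power_add pc mult.commute mult.left_commute)
  also have "\<dots> \<le> p ^ L"
    using p(1) KL by (intro power_increasing) auto
  also have "\<dots> \<le> real y"
    unfolding L_def by (rule scale_le[OF p(1) y1])
  finally have "(2 - p) * (p ^ (c - 1) * real x) \<le> (2 - p) * real y"
    using p(2) by (intro mult_left_mono) auto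
  moreover have "real a * real x \<le> (2 - p) * p ^ (c - 1) * real x"
    using a by (intro mult_right_mono) auto
  ultimately have "p * real y \<le> 2 * real y - real a * real x"
    by (simp add: algebra_simps)
  also have "\<dots> \<le> real z"
    by (simp add: z_eq algebra_simps)
  finally have LM: "L + c \<le> M"
    unfolding L_def M_def by (intro add_le_of_mod_eq scale_less p(1) y1 z1 yz)

  \<comment> \<open>Upper bound for z. The coefficient i - a may be negative, but its bound is not,
    so x may be replaced by p^(K+1) and then K + c by L. The term 2y < 2 p^(L+1) cancels the -2 in
    the bound, leaving p^(L+c).\<close>
  have "(real i - real a) * real x \<le> p ^ c * (p ^ (c - 1) - 2) * real x"
    using i by (intro mult_right_mono) auto
  also have "\<dots> \<le> p ^ c * (p ^ (c - 1) - 2) * p ^ (K + 1)"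
    using p(1) p2 less_scale[OF p(1) x] by (intro mult_left_mono) (auto simp: K_def)
  also have "\<dots> = (p ^ (c - 1) - 2) * p ^ (K + c + 1)"
    by (simp add: power_add mult_ac)
  also have "\<dots> \<le> (p ^ (c - 1) - 2) * p ^ (L + 1)"
    using p(1) p2 KL by (intro mult_left_mono power_increasing) auto
  finally have "real z < 2 * p ^ (L + 1) + (p ^ (c - 1) - 2) * p ^ (L + 1)"
    using less_scale[OF p(1) y1] unfolding z_eq L_def by linarith
  also have "\<dots> = p ^ (L + c)"
    by (simp add: power_add pc algebra_simps)
  also have "\<dots> \<le> p ^ M"
    using p(1) LM by (intro power_increasing) auto
  also have "\<dots> \<le> real z"
    unfolding M_def by (rule scale_le[OF p(1) z1])
  finally show False by simp
qed

lemma regular_mono: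
  assumes "regular s a b" "r \<le> s"
  shows "regular r a b"
  using assms unfolding regular_def by (metis Pi_mono lessThan_subset_iff subsetD)

lemma regular_1: "regular 1 a b"
proof -
  have "is_triple a b (1, a + 1, b + 2)"
    unfolding is_triple_def by (intro exI[of _ 1]) simp
  moreover have "f 1 = f (a + 1) \<and> f (a + 1) = f (b + 2)" if "f \<in> {1..} \<rightarrow> {..<1}" for f :: "nat \<Rightarrow> nat"
    using that by (auto simp: Pi_iff)
  ultimately show ?thesis
    unfolding regular_def admits_mono_triple_def by blast
qed

lemma dor_le_of_not_regular:
  assumes "1 \<le> c" "\<not> regular c a b"
  shows "dor a b \<le> enat (c - 1)"
proof -
  have bound: "r \<le> c - 1" if "1 \<le> r \<and> regular r a b" for r
    using that assms regular_mono[of r a b c] by (cases "c \<le> r") auto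
  \<comment> \<open>\<open>GREATEST\<close> needs an inhabited bounded set: r = 1 is a member and c
    - 1 is a bound.\<close>
  have "1 \<le> (GREATEST r. 1 \<le> r \<and> regular r a b) \<and> regular (GREATEST r. 1 \<le> r \<and> regular r a b) a b"
    by (rule GreatestI_nat[where k = 1 and b = "c - 1"]) (use regular_1 bound in auto)
  then have "(GREATEST r. 1 \<le> r \<and> regular r a b) \<le> c - 1"
    by (rule bound)
  then show ?thesis
    using assms by (auto simp: dor_def)
qed

theorem theorem2:
  fixes a i c :: nat and p :: real
  assumes "a \<ge> 2" and "c \<ge> 5"
    and "p = 2 - 2 / real c"
    and "0 \<le> i" and "real i \<le> p ^ c * (p ^ (c - 1) - 2)"
    and "real a \<le> p ^ c / (real c - 1)"
  shows "dor a (a + i) \<le> enat (c - 1)"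
proof (rule dor_le_of_not_regular)
  show "1 \<le> c"
    using assms(2) by simp
  have "2 / real c < 1" "0 \<le> 2 / real c"
    using assms(2) by auto
  then have p: "1 < p" "p \<le> 2"
    using assms(3) by linarith+
  have "0 \<le> p ^ c * (p ^ (c - 1) - 2)"
    using assms(5) of_nat_0_le_iff order_trans by blast
  moreover have "0 < p ^ c"
    using p by simp
  ultimately have p2: "2 \<le> p ^ (c - 1)"
    by (simp add: zero_le_mult_iff)
  \<comment> \<open>This identity is what the choice p = 2 - 2/c achieves: both sides equal 2/c, so
    the bound on a becomes (2 - p) p^(c-1).\<close>
  have "p / (real c - 1) = 2 - p"
    using assms(2,3) by (simp add: field_simps)
  moreover have "p ^ c = p * p ^ (c - 1)"
    using assms(2) by (cases c) auto
  ultimately have a: "real a \<le> (2 - p) * p ^ (c - 1)"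
    using assms(6) by (metis times_divide_eq_left)
  show "\<not> regular c a (a + i)"
  proof (rule not_regular_scale[OF p _ _ p2 a])
    show "p \<le> real a" "0 < c"
      using assms(1,2) p(2) by auto
    show "real i - real a \<le> p ^ c * (p ^ (c - 1) - 2)"
      using assms(5) by linarith
  qed
qed

end
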